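(* A 3-Star Nim position $([a_1],[a_2],[a_3])$ is a $\mathcal{P}$-position if and only if $a_1\oplus a_2\oplus a_3=0$.
   Context: $m$-Star Nim: $m$ strips of squares numbered $0,1,2,\ldots$ share their square $0$; each strip carries one token, and the shared square $0$ holds at most one token. A position is a tuple $([a_1],\ldots,[a_m])$ of nonnegative integers with at most one $a_i$ equal to $0$. A move replaces exactly one $a_i$ by a smaller nonnegative integer, provided the result is a legal position (so $a_i$ may be replaced by $0$ only if no other token is on square $0$). The game is impartial and a player unable to move loses. A $\mathcal{P}$-position is one from which the player about to move has no winning strategy; equivalently, its Sprague-Grundy value is $0$. $\oplus$ is Nim-sum (bitwise addition mod 2 of binary representations). *)

theory Defs
  imports Main
begin

unbundle bit_operations_syntax

type_synonym position = "nat list"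

(* Entry i of the list is the square occupied by the token on strip i. Only square 0 is
   shared between the strips, so equal positive entries denote different squares. *)
definition star_nim_position :: "nat \<Rightarrow> position \<Rightarrow> bool" where
  "star_nim_position m p \<longleftrightarrow> length p = m \<and> card {i. i < m \<and> p ! i = 0} \<le> 1"

definition star_nim_move :: "nat \<Rightarrow> position \<Rightarrow> position \<Rightarrow> bool" where
  "star_nim_move m p q \<longleftrightarrow>
     star_nim_position m p \<and> star_nim_position m q \<and>
     (\<exists>i < m. \<exists>b < p ! i. q = p[i := b])"

(* A strategy maps the history of a play, a list with the current position at its head, to
   the next position. The predicate says that the player about to move, following s from
   the history h on, always has a legal move available and that every play ends after
   finitely many moves with the opponent unable to move. *)
inductive wins_with :: "('a \<Rightarrow> 'a \<Rightarrow> bool) \<Rightarrow> ('a list \<Rightarrow> 'a) \<Rightarrow> 'a list \<Rightarrow> bool"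
  for mv :: "'a \<Rightarrow> 'a \<Rightarrow> bool" and s :: "'a list \<Rightarrow> 'a" where
  "mv (hd h) (s h) \<Longrightarrow> (\<And>r. mv (s h) r \<Longrightarrow> wins_with mv s (r # s h # h)) \<Longrightarrow> wins_with mv s h"

definition has_winning_strategy :: "('a \<Rightarrow> 'a \<Rightarrow> bool) \<Rightarrow> 'a \<Rightarrow> bool" where
  "has_winning_strategy mv p \<longleftrightarrow> (\<exists>s. wins_with mv s [p])"

definition star_nim_P_position :: "nat \<Rightarrow> position \<Rightarrow> bool" where
  "star_nim_P_position m p \<longleftrightarrow>
     star_nim_position m p \<and> \<not> has_winning_strategy (star_nim_move m) p"

end

theory Submission
  imports Defs
begin

text \<open>The positions of Nim-sum 0 are a kernel of the game: no move joins two of them, and every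
  other position has a move into them. For the second claim the usual Nim move is legal, since a
  legal position of three tokens has at least two positive entries, and in a triple of Nim-sum 0
  two entries 0 force the third to be 0 as well, so such a triple is not one move away. That some
  entry exceeds the Nim-sum of the other two is proved by halving: if the halves already have
  Nim-sum 0, each entry agrees with the Nim-sum of the others up to the last bit.\<close>

text \<open>By \<open>stable\<close> the strategy must step out of the kernel, and by
  \<open>absorbing\<close> the opponent can step back in, where the induction hypothesis applies to
  the extended history. \<open>absorbing\<close> is asked only at targets of moves: an illegal
  triple such as \<open>[0, 0, 1]\<close> lies outside the kernel used below and has no move at
  all.\<close>

lemma wins_with_imp_not_kernel:
  assumes stable: "\<And>p q. K p \<Longrightarrow> mv p q \<Longrightarrow> \<not> K q"
    and absorbing: "\<And>p q. mv p q \<Longrightarrow> \<not> K q \<Longrightarrow> \<exists>r. mv q r \<and> K r"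
    and "wins_with mv s h"
  shows "\<not> K (hd h)"
  using assms(3)
proof induction
  case (1 h)
  show ?case
  proof
    assume "K (hd h)"
    then have "\<not> K (s h)" using 1 stable by blast
    then obtain r where "mv (s h) r" "K r" using 1 absorbing by blast
    then show False using 1 by fastforce
  qed
qed

text \<open>The strategy ignores all but the head of the history and always moves into the kernel.
  Any reply \<open>r\<close> then leaves the kernel again, so a further kernel move exists, and the
  drop of \<open>f\<close> ends the play.\<close>

lemma not_kernel_imp_wins_with:
  fixes f :: "'a \<Rightarrow> nat"
  assumes decreasing: "\<And>p q. mv p q \<Longrightarrow> f q < f p"
    and stable: "\<And>p q. K p \<Longrightarrow> mv p q \<Longrightarrow> \<not> K q"
    and absorbing: "\<And>p q. mv p q \<Longrightarrow> \<not> K q \<Longrightarrow> \<exists>r. mv q r \<and> K r"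
    and "\<exists>q. mv (hd h) q \<and> K q"
  shows "wins_with mv (\<lambda>h. SOME q. mv (hd h) q \<and> K q) h"
    (is "wins_with mv ?s h")
  using assms(4)
proof (induction h rule: measure_induct_rule[of "\<lambda>h. f (hd h)"])
  case (less h)
  have s: "mv (hd h) (?s h)" "K (?s h)"
    using someI_ex[OF less.prems] by auto
  show ?case
  proof (rule wins_with.intros)
    show "mv (hd h) (?s h)" by (fact s)
  next
    fix r assume r: "mv (?s h) r"
    then have "f r < f (hd h)" using s(1) decreasing by (meson less_trans)
    moreover have "\<exists>q. mv r q \<and> K q" using r s(2) stable absorbing by blast
    ultimately show "wins_with mv ?s (r # ?s h # h)" by (intro less.IH) simp_all
  qed
qed

lemma xor_left_self:
  fixes a b :: nat
  shows "a XOR (a XOR b) = b"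
  by (simp flip: xor.assoc)

lemma xor_left_cancel_iff:
  fixes a b c :: nat
  shows "a XOR b = a XOR c \<longleftrightarrow> b = c"
  by (metis xor_left_self)

lemma xor_right_cancel_iff:
  fixes a b c :: nat
  shows "b XOR a = c XOR a \<longleftrightarrow> b = c"
  by (simp add: xor_left_cancel_iff xor.commute[of _ a])

lemma xor_eq_0_iff:
  fixes a b :: nat
  shows "a XOR b = 0 \<longleftrightarrow> a = b"
  using xor_left_cancel_iff[of a b a] by auto

lemma xor_div_2:
  fixes a b :: nat
  shows "(a XOR b) div 2 = a div 2 XOR b div 2"
  by (simp add: xor_rec[of a b])

lemma xor_less_cases:
  fixes a b c :: nat
  assumes "a XOR b XOR c \<noteq> 0"
  shows "b XOR c < a \<or> a XOR c < b \<or> a XOR b < c"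
  using assms
proof (induction "a + b + c" arbitrary: a b c rule: less_induct)
  case less
  have odd_less: "y < x" if "x div 2 = y div 2" "odd x" "even y" for x y :: nat
    using that by presburger
  have half_less: "y < x" if "y div 2 < x div 2" for x y :: nat
    using that by presburger
  show ?case
  proof (cases "a div 2 XOR b div 2 XOR c div 2 = 0")
    case True
    then have "a div 2 = b div 2 XOR c div 2"
      by (simp add: xor_eq_0_iff)
    then have "a div 2 = (b XOR c) div 2" "b div 2 = (a XOR c) div 2" "c div 2 = (a XOR b) div 2"
      by (simp_all add: xor_div_2 xor_left_self ac_simps)
    \<comment> \<open>The Nim-sum is nonzero with half 0, so it is 1. An odd entry then faces an
      even Nim-sum of the other two, and at least one entry is odd.\<close>
    moreover have "(a XOR b XOR c) div 2 = 0"
      using True by (simp add: xor_div_2)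
    then have "odd (a XOR b XOR c)"
      using less.prems by presburger
    then have "odd a \<and> even (b XOR c) \<or> odd b \<and> even (a XOR c) \<or> odd c \<and> even (a XOR b)"
      by (auto simp: even_xor_iff)
    ultimately show ?thesis
      using odd_less by metis
  next
    case False
    \<comment> \<open>Halving lowers the sum of the entries only if some entry is positive.\<close>
    have "a \<noteq> 0 \<or> b \<noteq> 0 \<or> c \<noteq> 0"
      using less.prems by auto
    then have "a div 2 + b div 2 + c div 2 < a + b + c"
      by presburger
    then have "(b XOR c) div 2 < a div 2 \<or> (a XOR c) div 2 < b div 2 \<or> (a XOR b) div 2 < c div 2"
      using less.hyps False by (simp add: xor_div_2)
    then show ?thesis
      using half_less by blast
  qed
qed

lemma star_nim_position_3_iff:
  "star_nim_position 3 [a, b, c] \<longleftrightarrow> \<not> (a = 0 \<and> b = 0 \<or> a = 0 \<and> c = 0 \<or> b = 0 \<and> c = 0)"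
proof -
  have "{i. i < 3 \<and> [a, b, c] ! i = 0} =
      (if a = 0 then {0} else {}) \<union> (if b = 0 then {1} else {}) \<union> (if c = 0 then {2} else {})"
    by (auto simp: less_Suc_eq numeral_3_eq_3 numeral_2_eq_2 nth_Cons')
  then show ?thesis
    by (auto simp: star_nim_position_def)
qed

lemma star_nim_move_3_iff:
  "star_nim_move 3 [a, b, c] q \<longleftrightarrow>
    star_nim_position 3 [a, b, c] \<and> star_nim_position 3 q \<and>
    ((\<exists>x<a. q = [x, b, c]) \<or> (\<exists>x<b. q = [a, x, c]) \<or> (\<exists>x<c. q = [a, b, x]))"
proof -
  have "(\<exists>i<3. P i) \<longleftrightarrow> P 0 \<or> P 1 \<or> P 2" for P :: "nat \<Rightarrow> bool"
    by (auto simp: less_Suc_eq numeral_3_eq_3 numeral_2_eq_2)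
  then show ?thesis
    by (auto simp: star_nim_move_def numeral_2_eq_2)
qed

theorem proposition2:
  fixes a1 a2 a3 :: nat
  assumes "star_nim_position 3 [a1, a2, a3]"
  shows "star_nim_P_position 3 [a1, a2, a3] \<longleftrightarrow> a1 XOR a2 XOR a3 = 0"
proof -
  \<comment> \<open>A fold makes \<open>K\<close> a predicate on lists of every length, as the
    kernel lemmas require.\<close>
  define K :: "position \<Rightarrow> bool" where "K p \<longleftrightarrow> fold (XOR) p 0 = 0" for p
  have K: "K [a, b, c] \<longleftrightarrow> a XOR b XOR c = 0" for a b c
    by (simp add: K_def ac_simps)
  have position: "\<exists>a b c. p = [a, b, c]" if "star_nim_position 3 p" for p
    using that by (auto simp: star_nim_position_def numeral_3_eq_3 length_Suc_conv)
  have move: "\<exists>a b c. p = [a, b, c]" if "star_nim_move 3 p q" for p q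
    using that position by (auto simp: star_nim_move_def)
  have decreasing: "sum_list q < sum_list p" if "star_nim_move 3 p q" for p q
    using that move[OF that] by (auto simp: star_nim_move_3_iff)
  have stable: "\<not> K q" if "K p" and pq: "star_nim_move 3 p q" for p q
  proof -
    obtain a b c where p: "p = [a, b, c]" using move[OF pq] by blast
    from pq consider x where "x < a" "q = [x, b, c]" | x where "x < b" "q = [a, x, c]"
      | x where "x < c" "q = [a, b, x]"
      by (auto simp: p star_nim_move_3_iff)
    \<comment> \<open>Cancelling the two unchanged entries would force \<open>x\<close> to equal the
      entry it replaced.\<close>
    then show ?thesis
      using \<open>K p\<close> by cases (auto simp: p K xor_eq_0_iff xor_left_cancel_iff xor_right_cancel_iff)
  qed
  have absorbing: "\<exists>q. star_nim_move 3 p q \<and> K q" if pos: "star_nim_position 3 p" and "\<not> K p" for p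
  proof -
    obtain a b c where p: "p = [a, b, c]" using position[OF pos] by blast
    have legal: "\<not> (a = 0 \<and> b = 0 \<or> a = 0 \<and> c = 0 \<or> b = 0 \<and> c = 0)"
      using pos by (simp add: p star_nim_position_3_iff)
    \<comment> \<open>For legality of the new triple: if the new entry is 0, the two kept entries
      are equal, so a second 0 would make both kept entries 0, against \<open>legal\<close>.\<close>
    have xor_zero: "x = y" if "x XOR y = 0" for x y :: nat
      using that by (simp add: xor_eq_0_iff)
    consider "b XOR c < a" | "a XOR c < b" | "a XOR b < c"
      using xor_less_cases \<open>\<not> K p\<close> by (auto simp: p K)
    then show ?thesis
    proof cases
      case 1
      then have "star_nim_move 3 p [b XOR c, b, c]"
        using legal by (auto simp: p star_nim_move_3_iff star_nim_position_3_iff dest: xor_zero)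
      then show ?thesis by (auto simp: K xor_eq_0_iff)
    next
      case 2
      then have "star_nim_move 3 p [a, a XOR c, c]"
        using legal by (auto simp: p star_nim_move_3_iff star_nim_position_3_iff dest: xor_zero)
      moreover have "K [a, a XOR c, c]" by (simp add: K xor_left_self xor.assoc)
      ultimately show ?thesis by blast
    next
      case 3
      then have "star_nim_move 3 p [a, b, a XOR b]"
        using legal by (auto simp: p star_nim_move_3_iff star_nim_position_3_iff dest: xor_zero)
      moreover have "K [a, b, a XOR b]" by (simp add: K xor_left_self ac_simps)
      ultimately show ?thesis by blast
    qed
  qed
  have absorbing': "\<exists>r. star_nim_move 3 q r \<and> K r" if "star_nim_move 3 p q" "\<not> K q" for p q
    using that absorbing by (simp add: star_nim_move_def)
  have "has_winning_strategy (star_nim_move 3) [a1, a2, a3] \<longleftrightarrow> \<not> K [a1, a2, a3]"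
  proof
    assume "has_winning_strategy (star_nim_move 3) [a1, a2, a3]"
    then obtain s where "wins_with (star_nim_move 3) s [[a1, a2, a3]]"
      unfolding has_winning_strategy_def by blast
    from wins_with_imp_not_kernel[of K, OF _ _ this] show "\<not> K [a1, a2, a3]"
      using stable absorbing' by (metis list.sel(1))
  next
    assume "\<not> K [a1, a2, a3]"
    then have "\<exists>q. star_nim_move 3 (hd [[a1, a2, a3]]) q \<and> K q"
      using absorbing assms by simp
    then have "wins_with (star_nim_move 3) (\<lambda>h. SOME q. star_nim_move 3 (hd h) q \<and> K q) [[a1, a2, a3]]"
      using decreasing stable absorbing' by (intro not_kernel_imp_wins_with[where f = sum_list])
    then show "has_winning_strategy (star_nim_move 3) [a1, a2, a3]"
      unfolding has_winning_strategy_def by blast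
  qed
  then show ?thesis
    using assms by (simp add: star_nim_P_position_def K)
qed

end
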